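(* Suppose that the random measure $G$ satisfies the Ghirlanda-Guerra identities and let $q^*$ be the supremum of the support of $\mu$. If $\mu(\{q^*\})<1$, then with probability one the support of $G$ is not totally bounded.
   Context: $G$ is a random probability measure on the unit ball of a separable Hilbert space $H$; $(\sigma^l)_{l\geq 1}$ is an i.i.d. sequence from $G$; $\langle\cdot\rangle$ is the average with respect to $G^{\otimes\infty}$; $\mathbb{E}$ is the expectation with respect to the randomness of $G$. $R_{l,l'}=\sigma^l\cdot\sigma^{l'}$ is the scalar product (overlap), and $\mu$ is the law of $R_{1,2}$ under $\mathbb{E}G^{\otimes 2}$. Ghirlanda-Guerra identities: for any $n\geq 2$, any bounded measurable function $f$ of the overlaps $(R_{l,l'})_{l,l'\leq n}$ and any bounded measurable function $\psi$ of one overlap, $$\mathbb{E}\langle f\psi(R_{1,n+1})\rangle=\frac1n\,\mathbb{E}\langle f\rangle\,\mathbb{E}\langle\psi(R_{1,2})\rangle+\frac1n\sum_{l=2}^n\mathbb{E}\langle f\psi(R_{1,l})\rangle .$$ *)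

theory Defs
  imports "HOL-Probability.Probability"
begin

text \<open>The random measure \<open>G\<close> is a measurable map from the probability space \<open>M\<close> into the
  probability measures on the Borel sets of the Hilbert space (Giry sigma-algebra, generated by
  the evaluations \<open>G \<mapsto> G(A)\<close>), carried by the closed unit ball.\<close>

definition random_prob_on_unit_ball ::
    "'w measure \<Rightarrow> ('w \<Rightarrow> 'h::{real_inner, banach, second_countable_topology} measure) \<Rightarrow> bool"
  where "random_prob_on_unit_ball M G \<longleftrightarrow>
    G \<in> M \<rightarrow>\<^sub>M prob_algebra borel \<and>
    (\<forall>\<omega>\<in>space M. measure (G \<omega>) (cball 0 1) = 1)"

definition replica_average ::
    "'h::{real_inner, banach, second_countable_topology} measure \<Rightarrow> ((nat \<Rightarrow> 'h) \<Rightarrow> real) \<Rightarrow> real"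
  where "replica_average \<nu> X = (\<integral>\<sigma>. X \<sigma> \<partial>(\<Pi>\<^sub>M l\<in>{1::nat..}. \<nu>))"

definition mean_average ::
    "'w measure \<Rightarrow> ('w \<Rightarrow> 'h::{real_inner, banach, second_countable_topology} measure) \<Rightarrow>
      ((nat \<Rightarrow> 'h) \<Rightarrow> real) \<Rightarrow> real"
  where "mean_average M G X = (\<integral>\<omega>. replica_average (G \<omega>) X \<partial>M)"

definition overlap :: "(nat \<Rightarrow> 'h::real_inner) \<Rightarrow> nat \<Rightarrow> nat \<Rightarrow> real"
  where "overlap \<sigma> l l' = \<sigma> l \<bullet> \<sigma> l'"

definition overlap_array :: "nat \<Rightarrow> (nat \<Rightarrow> 'h::real_inner) \<Rightarrow> nat \<times> nat \<Rightarrow> real"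
  where "overlap_array n \<sigma> = (\<lambda>(l, l')\<in>{1..n} \<times> {1..n}. overlap \<sigma> l l')"

abbreviation overlap_space :: "nat \<Rightarrow> (nat \<times> nat \<Rightarrow> real) measure"
  where "overlap_space n \<equiv> (\<Pi>\<^sub>M p\<in>{1..n} \<times> {1..n}. borel)"

definition ghirlanda_guerra ::
    "'w measure \<Rightarrow> ('w \<Rightarrow> 'h::{real_inner, banach, second_countable_topology} measure) \<Rightarrow> bool"
  where "ghirlanda_guerra M G \<longleftrightarrow>
    (\<forall>n\<ge>2. \<forall>f \<in> borel_measurable (overlap_space n). \<forall>\<psi> \<in> borel_measurable borel.
      bounded (f ` space (overlap_space n)) \<longrightarrow> bounded (range \<psi>) \<longrightarrow>
      mean_average M G (\<lambda>\<sigma>. f (overlap_array n \<sigma>) * \<psi> (overlap \<sigma> 1 (n + 1))) =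
        1 / real n * mean_average M G (\<lambda>\<sigma>. f (overlap_array n \<sigma>))
                   * mean_average M G (\<lambda>\<sigma>. \<psi> (overlap \<sigma> 1 2)) +
        1 / real n * (\<Sum>l=2..n. mean_average M G
                         (\<lambda>\<sigma>. f (overlap_array n \<sigma>) * \<psi> (overlap \<sigma> 1 l))))"

text \<open>The law of \<open>R\<^sub>1\<^sub>,\<^sub>2\<close> under the mean measure \<open>E G \<otimes> G\<close>; the Giry bind forms the mean.\<close>

definition overlap_law ::
    "'w measure \<Rightarrow> ('w \<Rightarrow> 'h::{real_inner, banach, second_countable_topology} measure) \<Rightarrow> real measure"
  where "overlap_law M G =
    distr (M \<bind> (\<lambda>\<omega>. G \<omega> \<Otimes>\<^sub>M G \<omega>)) borel (\<lambda>(x, y). x \<bullet> y)"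

definition measure_support :: "'a::topological_space measure \<Rightarrow> 'a set"
  where "measure_support \<nu> = {x. \<forall>U. open U \<longrightarrow> x \<in> U \<longrightarrow> 0 < emeasure \<nu> U}"

end

theory Submission
  imports Defs
begin

text \<open>
  Why the theorem holds. Write \<open>\<mu>\<close> for the law of \<open>R\<^sub>1\<^sub>,\<^sub>2\<close>, let \<open>B\<close> be a Borel set of reals, call two
  replicas \<^emph>\<open>close\<close> if their overlap lies in \<open>B\<close>, and let \<open>b = \<mu> B < 1\<close>. The key fact
  (\<open>AE_not_covered\<close>) is that almost surely, if no two of the first \<open>n\<close> replicas are close to each
  other, then some later replica is close to none of them. To see this, let \<open>E m\<close> be the event that
  the first \<open>n\<close> replicas are pairwise not close while each of the next \<open>m\<close> is close to one of them,
  and let \<open>c m\<close> be the probability of \<open>E m\<close> and \<open>R\<^sub>1\<^sub>,\<^sub>n\<^sub>+\<^sub>1 \<in> B\<close>. The Ghirlanda-Guerra identity for \<open>n + m\<close>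
  replicas, together with exchangeability, gives
  \<open>c (m + 1) \<le> (b * P (E m) + m * c m) / (n + m)\<close>: of the terms \<open>R\<^sub>1\<^sub>,\<^sub>l\<close>, those with \<open>l \<le> n\<close> vanish on
  \<open>E m\<close>, and the \<open>m\<close> others are equal. A union bound over the first \<open>n\<close> replicas gives
  \<open>P (E m) \<le> n * c m\<close>. Hence \<open>c m - c (m + 1) \<ge> (1 - b) * P (E m) / (n + m)\<close>, and since the harmonic
  series diverges, \<open>P (E m)\<close> cannot stay bounded away from \<open>0\<close>.

  This is used for two choices of \<open>B\<close>. With \<open>n = 1\<close> and \<open>B = {..q\<^sup>* - \<delta>}\<close> it says that almost every
  \<open>\<sigma>\<^sup>1\<close> meets replicas with overlap above \<open>q\<^sup>* - \<delta>\<close>. As points of the support of \<open>G\<close> have squared norm at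
  most \<open>q\<^sup>*\<close> (\<open>support_norm_le\<close>), the Cauchy-Schwarz inequality forces \<open>\<sigma>\<^sup>1\<close> to have squared norm at
  least \<open>q\<^sup>*\<close> (\<open>AE_replicas_norm_ge\<close>). With \<open>B = {c<..}\<close>, where \<open>c < q\<^sup>*\<close> and \<open>\<mu> {..c} > 0\<close>, an induction
  on \<open>n\<close> for fixed \<open>G\<close> (\<open>separated_positive\<close>) shows that for every \<open>n\<close> there are with positive
  probability \<open>n\<close> replicas with pairwise overlaps at most \<open>c\<close>. They lie in the support, and their
  mutual distances are at least \<open>sqrt (2 * (q\<^sup>* - c))\<close>, independently of \<open>n\<close>; so the support is not
  totally bounded. Such a \<open>c\<close> exists because \<open>\<mu> {q\<^sup>*} < 1\<close>.
\<close>

(* Replica indices start at 1; keeping 1 unexpanded preserves the form {1..} of the index set. *)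
declare One_nat_def [simp del]

section \<open>Products, supports and two elementary criteria\<close>

text \<open>The product over any index set of copies of a random probability measure is again a random
  probability measure; the cylinder sets generate the product sigma-algebra.\<close>

lemma measurable_PiM_kernel:
  fixes N :: "'a measure"
  assumes G: "G \<in> M \<rightarrow>\<^sub>M prob_algebra N"
  shows "(\<lambda>\<omega>. \<Pi>\<^sub>M i\<in>I. G \<omega>) \<in> M \<rightarrow>\<^sub>M prob_algebra (\<Pi>\<^sub>M i\<in>I. N)"
proof (rule measurable_prob_algebra_generated[OF sets_PiM Int_stable_prod_algebra prod_algebra_sets_into_space])
  fix \<omega> assume \<omega>: "\<omega> \<in> space M"
  then have "G \<omega> \<in> space (prob_algebra N)"
    using G by (rule measurable_space[rotated])
  then show "prob_space (\<Pi>\<^sub>M i\<in>I. G \<omega>)" "sets (\<Pi>\<^sub>M i\<in>I. G \<omega>) = sets (\<Pi>\<^sub>M i\<in>I. N)"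
    by (auto simp: space_prob_algebra intro!: prob_space_PiM sets_PiM_cong)
next
  fix A assume "A \<in> prod_algebra I (\<lambda>i. N)"
  then obtain J E where J: "A = prod_emb I (\<lambda>i. N) J (\<Pi>\<^sub>E j\<in>J. E j)" "finite J" "J \<subseteq> I"
      "\<And>i. i \<in> J \<Longrightarrow> E i \<in> sets N"
    by (rule prod_algebraE) blast
  have "emeasure (\<Pi>\<^sub>M i\<in>I. G \<omega>) A = (\<Prod>j\<in>J. emeasure (G \<omega>) (E j))" if "\<omega> \<in> space M" for \<omega>
  proof -
    have sp: "G \<omega> \<in> space (prob_algebra N)"
      using measurable_space[OF G that] .
    then have "prod_emb I (\<lambda>i. N) J (\<Pi>\<^sub>E j\<in>J. E j) = prod_emb I (\<lambda>i. G \<omega>) J (\<Pi>\<^sub>E j\<in>J. E j)"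
      by (auto simp: prod_emb_def space_prob_algebra dest: sets_eq_imp_space_eq)
    with sp show ?thesis
      unfolding J(1) using J by (auto simp: space_prob_algebra intro!: emeasure_PiM_emb)
  qed
  moreover have "(\<lambda>\<omega>. \<Prod>j\<in>J. emeasure (G \<omega>) (E j)) \<in> borel_measurable M"
    using J(4) by (intro borel_measurable_prod_ennreal measurable_compose[OF measurable_prob_algebraD[OF G]]
        measurable_emeasure_subprob_algebra)
  ultimately show "(\<lambda>\<omega>. emeasure (\<Pi>\<^sub>M i\<in>I. G \<omega>) A) \<in> borel_measurable M"
    by (simp cong: measurable_cong)
qed

lemma distr_PiM_pair:
  assumes "prob_space \<nu>" "i \<in> I" "j \<in> I" "i \<noteq> j"
  shows "distr (\<Pi>\<^sub>M l\<in>I. \<nu>) (\<nu> \<Otimes>\<^sub>M \<nu>) (\<lambda>\<sigma>. (\<sigma> i, \<sigma> j)) = \<nu> \<Otimes>\<^sub>M \<nu>"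
proof -
  interpret prob_space \<nu> by fact
  interpret P: product_prob_space "\<lambda>_. \<nu>" I ..
  show ?thesis
  proof (rule pair_measure_eqI[symmetric])
    fix A B assume AB: "A \<in> sets \<nu>" "B \<in> sets \<nu>"
    have "emeasure (distr (\<Pi>\<^sub>M l\<in>I. \<nu>) (\<nu> \<Otimes>\<^sub>M \<nu>) (\<lambda>\<sigma>. (\<sigma> i, \<sigma> j))) (A \<times> B) =
        emeasure (\<Pi>\<^sub>M l\<in>I. \<nu>) {\<sigma>\<in>space (\<Pi>\<^sub>M l\<in>I. \<nu>). \<forall>l\<in>{i, j}. \<sigma> l \<in> (if l = i then A else B)}"
      using AB assms by (subst emeasure_distr) (auto intro!: arg_cong[where f="emeasure _"])
    also have "\<dots> = emeasure \<nu> A * emeasure \<nu> B"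
      using AB assms by (subst P.emeasure_PiM_Collect) auto
    finally show "emeasure \<nu> A * emeasure \<nu> B =
        emeasure (distr (\<Pi>\<^sub>M l\<in>I. \<nu>) (\<nu> \<Otimes>\<^sub>M \<nu>) (\<lambda>\<sigma>. (\<sigma> i, \<sigma> j))) (A \<times> B)" ..
  qed (auto intro: sigma_finite_measure_axioms)
qed

lemma AE_measure_support:
  fixes \<nu> :: "'a::second_countable_topology measure"
  assumes "sets \<nu> = sets borel"
  shows "AE x in \<nu>. x \<in> measure_support \<nu>"
proof -
  obtain \<B> :: "'a set set" where \<B>: "countable \<B>" "topological_basis \<B>"
    using ex_countable_basis by blast
  have "AE x in \<nu>. \<forall>U\<in>{U\<in>\<B>. emeasure \<nu> U = 0}. x \<notin> U"
  proof (rule AE_ball_countable[THEN iffD2])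
    show "countable {U \<in> \<B>. emeasure \<nu> U = 0}" using \<B>(1) by (rule countable_subset[rotated]) blast
    show "\<forall>U\<in>{U \<in> \<B>. emeasure \<nu> U = 0}. AE x in \<nu>. x \<notin> U"
    proof
      fix U assume "U \<in> {U \<in> \<B>. emeasure \<nu> U = 0}"
      then have "emeasure \<nu> U = 0" "open U"
        using topological_basis_open[OF \<B>(2)] by blast+
      then have "U \<in> null_sets \<nu>"
        by (intro null_setsI) (simp_all add: assms)
      then show "AE x in \<nu>. x \<notin> U" by (rule AE_not_in)
    qed
  qed
  then show ?thesis
  proof (rule AE_mp, intro AE_I2 impI)
    fix x
    assume x: "\<forall>U\<in>{U\<in>\<B>. emeasure \<nu> U = 0}. x \<notin> U"
    show "x \<in> measure_support \<nu>"
      unfolding measure_support_def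
    proof safe
      fix U assume "open U" "x \<in> U"
      then obtain V where "V \<in> \<B>" "x \<in> V" "V \<subseteq> U"
        by (rule topological_basisE[OF \<B>(2)])
      with x have "0 < emeasure \<nu> V" by (auto simp: zero_less_iff_neq_zero)
      also have "\<dots> \<le> emeasure \<nu> U"
        using \<open>V \<subseteq> U\<close> \<open>open U\<close> by (intro emeasure_mono) (simp_all add: assms)
      finally show "0 < emeasure \<nu> U" .
    qed
  qed
qed

text \<open>A set that contains arbitrarily many points at mutual distance at least a fixed \<open>r\<close> is not
  totally bounded: by pigeonhole, two of them would share a ball of radius \<open>r / 2\<close>.\<close>

lemma not_totally_boundedI:
  fixes S :: "'a::metric_space set"
  assumes "0 < r"
    and sep: "\<And>n::nat. 1 \<le> n \<Longrightarrow> \<exists>x. (\<forall>i\<in>{1..n}. x i \<in> S) \<and>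
        (\<forall>i\<in>{1..n}. \<forall>j\<in>{1..n}. i \<noteq> j \<longrightarrow> r \<le> dist (x i) (x j))"
  shows "\<not> totally_bounded S"
proof
  assume "totally_bounded S"
  then have "\<forall>e>0. \<exists>K. finite K \<and> S \<subseteq> (\<Union>y\<in>K. {x. dist y x < e})"
    unfolding totally_bounded_metric .
  from this[rule_format, of "r / 2"] \<open>0 < r\<close>
  obtain K where K: "finite K" "S \<subseteq> (\<Union>y\<in>K. {x. dist y x < r / 2})"
    by auto
  obtain x where x: "\<And>i. i \<in> {1..card K + 1} \<Longrightarrow> x i \<in> S"
      "\<And>i j. i \<in> {1..card K + 1} \<Longrightarrow> j \<in> {1..card K + 1} \<Longrightarrow> i \<noteq> j \<Longrightarrow> r \<le> dist (x i) (x j)"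
    using sep[of "card K + 1"] by (metis le_add2)
  have "\<forall>i\<in>{1..card K + 1}. \<exists>y\<in>K. dist y (x i) < r / 2"
    using K(2) x(1) by blast
  then obtain g where g: "\<And>i. i \<in> {1..card K + 1} \<Longrightarrow> g i \<in> K \<and> dist (g i) (x i) < r / 2"
    by metis
  have "\<not> inj_on g {1..card K + 1}"
  proof
    assume "inj_on g {1..card K + 1}"
    moreover have "g ` {1..card K + 1} \<subseteq> K" using g by auto
    ultimately have "card {1..card K + 1} \<le> card K"
      using K(1) by (metis card_inj_on_le)
    then show False by simp
  qed
  then obtain i j where ij: "i \<in> {1..card K + 1}" "j \<in> {1..card K + 1}" "i \<noteq> j" "g i = g j"
    by (auto simp: inj_on_def)
  have "dist (x i) (x j) \<le> dist (g i) (x i) + dist (g i) (x j)"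
    by (metis dist_commute dist_triangle)
  also have "\<dots> < r" using g[OF ij(1)] g[OF ij(2)] ij(4) by auto
  finally show False using x(2)[OF ij(1-3)] by simp
qed

text \<open>A nonnegative sequence cannot decrease by a fixed positive multiple of the harmonic series.\<close>

lemma harmonic_descent:
  fixes c :: "nat \<Rightarrow> real"
  assumes "\<And>m. c (Suc m) \<le> c m - e / real (m + k + 1)" "\<And>m. 0 \<le> c m"
  shows "e \<le> 0"
proof (rule ccontr)
  assume "\<not> e \<le> 0" then have "0 < e" by simp
  have "summable (\<lambda>m. e / real (m + k + 1))"
  proof (rule summableI_nonneg_bounded)
    fix n
    have "(\<Sum>m<n. e / real (m + k + 1)) \<le> c 0 - c n"
    proof (induction n)
      case (Suc n)
      then show ?case using assms(1)[of n] by simp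
    qed simp
    also have "\<dots> \<le> c 0" using assms(2)[of n] by simp
    finally show "(\<Sum>m<n. e / real (m + k + 1)) \<le> c 0" .
  qed (use \<open>0 < e\<close> in simp)
  from summable_mult[OF this, of "1 / e"] have "summable (\<lambda>m. inverse (real (m + (k + 1))))"
    using \<open>0 < e\<close> by (simp add: field_simps)
  then have "summable (\<lambda>m. inverse (real m))"
    by (subst (asm) summable_iff_shift)
  then show False using not_summable_harmonic[where 'a=real] by simp
qed

section \<open>Sequences of replicas\<close>

text \<open>The law of an i.i.d. sequence from \<open>\<nu>\<close>, indexed by \<open>1, 2, \<dots>\<close>.\<close>

abbreviation replicas :: "'h measure \<Rightarrow> (nat \<Rightarrow> 'h) measure"
  where "replicas \<nu> \<equiv> \<Pi>\<^sub>M l\<in>{1::nat..}. \<nu>"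

text \<open>No condition on the index is needed: outside of \<open>I\<close> the coordinate is constantly
  \<open>undefined\<close> on the product space. This makes overlaps measurable for all indices.\<close>

lemma measurable_PiM_borel_component [measurable]:
  "(\<lambda>x. x i) \<in> (\<Pi>\<^sub>M i\<in>I. borel :: 'b::topological_space measure) \<rightarrow>\<^sub>M borel"
proof (cases "i \<in> I")
  case False
  then have "(\<lambda>x. x i) \<in> (\<Pi>\<^sub>M i\<in>I. borel :: 'b measure) \<rightarrow>\<^sub>M borel \<longleftrightarrow>
      (\<lambda>x. undefined :: 'b) \<in> (\<Pi>\<^sub>M i\<in>I. borel :: 'b measure) \<rightarrow>\<^sub>M borel"
    by (intro measurable_cong) (auto simp: space_PiM PiE_def extensional_def)
  then show ?thesis by simp
qed (rule measurable_component_singleton)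

lemma measurable_overlap [measurable]:
  "(\<lambda>\<sigma>. overlap \<sigma> l l') \<in> borel_measurable
     (replicas (borel :: 'h::{real_inner, second_countable_topology} measure))"
  unfolding overlap_def by measurable

lemma measurable_overlap_array [measurable]:
  "overlap_array n \<in> replicas (borel :: 'h::{real_inner, second_countable_topology} measure) \<rightarrow>\<^sub>M overlap_space n"
  unfolding overlap_array_def
  by (intro measurable_restrict) (auto simp: case_prod_beta)

text \<open>The sequence with \<open>\<sigma> (\<pi> l)\<close> in place \<open>l\<close>, restricted to the indices from \<open>1\<close> on, so that it is
  again a point of the product space.\<close>

definition relabel :: "(nat \<Rightarrow> nat) \<Rightarrow> (nat \<Rightarrow> 'h) \<Rightarrow> nat \<Rightarrow> 'h"
  where "relabel \<pi> \<sigma> = (\<lambda>l\<in>{1..}. \<sigma> (\<pi> l))"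

lemma overlap_relabel [simp]:
  "1 \<le> l \<Longrightarrow> 1 \<le> l' \<Longrightarrow> overlap (relabel \<pi> \<sigma>) l l' = overlap \<sigma> (\<pi> l) (\<pi> l')"
  by (simp add: overlap_def relabel_def)

lemma overlap_commute: "overlap \<sigma> l l' = overlap \<sigma> l' l"
  by (simp add: overlap_def inner_commute)

lemma measurable_relabel [measurable]:
  "relabel \<pi> \<in> replicas (borel :: 'h::topological_space measure) \<rightarrow>\<^sub>M replicas borel"
  unfolding relabel_def by (intro measurable_restrict) measurable

lemma distr_relabel:
  assumes "prob_space \<nu>" "inj_on \<pi> {1..}" "\<pi> \<in> {1..} \<rightarrow> {1..}"
  shows "distr (replicas \<nu>) (replicas \<nu>) (relabel \<pi>) = replicas \<nu>"
  unfolding relabel_def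
  using distr_PiM_reindex[of "{1::nat..}" "\<lambda>_. \<nu>" \<pi> "{1..}"] assms by simp

lemma sets_replicas: "sets \<nu> = sets borel \<Longrightarrow> sets (replicas \<nu>) = sets (replicas borel)"
  by (intro sets_PiM_cong) auto

lemma AE_relabel:
  fixes \<nu> :: "'h::topological_space measure"
  assumes \<nu>: "prob_space \<nu>" "sets \<nu> = sets borel" and \<pi>: "inj_on \<pi> {1..}" "\<pi> \<in> {1..} \<rightarrow> {1..}"
    and ae: "AE \<sigma> in replicas \<nu>. P \<sigma>"
  shows "AE \<sigma> in replicas \<nu>. P (relabel \<pi> \<sigma>)"
proof -
  have *: "relabel \<pi> \<in> replicas \<nu> \<rightarrow>\<^sub>M replicas borel"
    using measurable_relabel[of \<pi>]
    by (subst measurable_cong_sets[OF sets_replicas[OF \<nu>(2)] refl])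
  have "distr (replicas \<nu>) (replicas borel) (relabel \<pi>) = replicas \<nu>"
    using distr_relabel[OF \<nu>(1) \<pi>]
    by (subst distr_cong[OF refl sets_replicas[OF \<nu>(2), symmetric] refl])
  then have "AE \<sigma> in distr (replicas \<nu>) (replicas borel) (relabel \<pi>). P \<sigma>"
    by (rule ssubst[where P="\<lambda>N. AE \<sigma> in N. P \<sigma>"]) (rule ae)
  then show ?thesis
    by (rule AE_distrD[OF *])
qed

text \<open>No two of the first \<open>n\<close> replicas have their overlap in \<open>B\<close>.\<close>

definition separated :: "real set \<Rightarrow> nat \<Rightarrow> (nat \<Rightarrow> 'h::real_inner) \<Rightarrow> bool"
  where "separated B n \<sigma> \<longleftrightarrow> (\<forall>l\<in>{1..n}. \<forall>l'\<in>{1..n}. l \<noteq> l' \<longrightarrow> overlap \<sigma> l l' \<notin> B)"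

text \<open>Each of the replicas \<open>n + 1, \<dots>, n + m\<close> has its overlap with one of the first \<open>n\<close> in \<open>B\<close>.\<close>

definition covered :: "real set \<Rightarrow> nat \<Rightarrow> nat \<Rightarrow> (nat \<Rightarrow> 'h::real_inner) \<Rightarrow> bool"
  where "covered B n m \<sigma> \<longleftrightarrow> (\<forall>j\<in>{n+1..n+m}. \<exists>l\<in>{1..n}. overlap \<sigma> l j \<in> B)"

lemma measurable_separated [measurable]:
  assumes [measurable]: "B \<in> sets borel"
  shows "Measurable.pred (replicas (borel :: 'h::{real_inner, second_countable_topology} measure)) (separated B n)"
  unfolding separated_def by measurable

lemma measurable_covered [measurable]:
  assumes [measurable]: "B \<in> sets borel"
  shows "Measurable.pred (replicas (borel :: 'h::{real_inner, second_countable_topology} measure)) (covered B n m)"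
  unfolding covered_def by measurable

lemma separated_relabel:
  assumes "inj_on \<pi> {1..n}" "\<pi> ` {1..n} = {1..n}"
  shows "separated B n (relabel \<pi> \<sigma>) \<longleftrightarrow> separated B n \<sigma>"
proof -
  have "separated B n (relabel \<pi> \<sigma>) \<longleftrightarrow>
      (\<forall>l\<in>{1..n}. \<forall>l'\<in>{1..n}. \<pi> l \<noteq> \<pi> l' \<longrightarrow> overlap \<sigma> (\<pi> l) (\<pi> l') \<notin> B)"
    unfolding separated_def using assms(1) by (auto simp: inj_on_eq_iff)
  also have "\<dots> \<longleftrightarrow> (\<forall>l\<in>\<pi> ` {1..n}. \<forall>l'\<in>\<pi> ` {1..n}. l \<noteq> l' \<longrightarrow> overlap \<sigma> l l' \<notin> B)"
    by blast
  finally show ?thesis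
    unfolding assms(2) separated_def .
qed

lemma covered_relabel:
  assumes "\<pi> ` {1..n} = {1..n}" "\<pi> ` {n+1..n+m} = {n+1..n+m}"
  shows "covered B n m (relabel \<pi> \<sigma>) \<longleftrightarrow> covered B n m \<sigma>"
proof -
  have "covered B n m (relabel \<pi> \<sigma>) \<longleftrightarrow>
      (\<forall>j\<in>{n+1..n+m}. \<exists>l\<in>{1..n}. overlap \<sigma> (\<pi> l) (\<pi> j) \<in> B)"
    unfolding covered_def by auto
  also have "\<dots> \<longleftrightarrow> (\<forall>j\<in>\<pi> ` {n+1..n+m}. \<exists>l\<in>\<pi> ` {1..n}. overlap \<sigma> l j \<in> B)"
    by blast
  finally show ?thesis
    unfolding assms covered_def .
qed

section \<open>The mean law of the replicas\<close>

locale random_measure =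
  fixes M :: "'w measure"
    and G :: "'w \<Rightarrow> 'h::{real_inner, banach, second_countable_topology} measure"
  assumes prob_space_M: "prob_space M"
    and random_prob: "random_prob_on_unit_ball M G"
begin

sublocale prob_space M by (rule prob_space_M)

lemma measurable_G: "G \<in> M \<rightarrow>\<^sub>M prob_algebra borel"
  using random_prob by (simp add: random_prob_on_unit_ball_def)

lemma prob_space_G: "\<omega> \<in> space M \<Longrightarrow> prob_space (G \<omega>)"
  and sets_G: "\<omega> \<in> space M \<Longrightarrow> sets (G \<omega>) = sets borel"
  using measurable_space[OF measurable_G] by (auto simp: space_prob_algebra)

lemma measurable_replicas: "(\<lambda>\<omega>. replicas (G \<omega>)) \<in> M \<rightarrow>\<^sub>M prob_algebra (replicas borel)"
  by (rule measurable_PiM_kernel[OF measurable_G])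

text \<open>The mean law \<open>E G\<^sup>\<infinity>\<close> of the replicas on the space of sequences.\<close>

definition mean_replicas :: "(nat \<Rightarrow> 'h) measure"
  where "mean_replicas = M \<bind> (\<lambda>\<omega>. replicas (G \<omega>))"

lemma sets_mean_replicas [measurable_cong]: "sets mean_replicas = sets (replicas borel)"
  unfolding mean_replicas_def
  by (rule sets_bind[OF _ not_empty]) (rule sets_replicas, rule sets_G)

lemma space_mean_replicas: "space mean_replicas = space (replicas borel)"
  by (rule sets_eq_imp_space_eq[OF sets_mean_replicas])

sublocale N: prob_space mean_replicas
  unfolding mean_replicas_def
  by (rule prob_space_bind[OF AE_I2 measurable_prob_algebraD[OF measurable_replicas]])
    (rule prob_space_PiM, rule prob_space_G)

lemma AE_mean_replicas:
  assumes "Measurable.pred (replicas borel) P"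
  shows "(AE \<sigma> in mean_replicas. P \<sigma>) \<longleftrightarrow> (AE \<omega> in M. AE \<sigma> in replicas (G \<omega>). P \<sigma>)"
  unfolding mean_replicas_def
  by (rule AE_bind[OF measurable_prob_algebraD[OF measurable_replicas] assms])

lemma distr_relabel_mean:
  assumes "inj_on \<pi> {1..}" "\<pi> \<in> {1..} \<rightarrow> {1..}"
  shows "distr mean_replicas (replicas borel) (relabel \<pi>) = mean_replicas"
proof -
  have "distr mean_replicas (replicas borel) (relabel \<pi>) =
      M \<bind> (\<lambda>\<omega>. distr (replicas (G \<omega>)) (replicas borel) (relabel \<pi>))"
    unfolding mean_replicas_def
    by (rule distr_bind[OF measurable_prob_algebraD[OF measurable_replicas] not_empty measurable_relabel])
  also have "\<dots> = mean_replicas"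
    unfolding mean_replicas_def
  proof (rule bind_cong[OF refl])
    fix \<omega> assume \<omega>: "\<omega> \<in> space M"
    show "distr (replicas (G \<omega>)) (replicas borel) (relabel \<pi>) = replicas (G \<omega>)"
      using distr_relabel[OF prob_space_G[OF \<omega>] assms]
      by (subst distr_cong[OF refl sets_replicas[OF sets_G[OF \<omega>], symmetric] refl])
  qed
  finally show ?thesis .
qed

lemma prob_relabel:
  assumes P: "Measurable.pred (replicas borel) P" and \<pi>: "inj_on \<pi> {1..}" "\<pi> \<in> {1..} \<rightarrow> {1..}"
  shows "\<P>(\<sigma> in mean_replicas. P (relabel \<pi> \<sigma>)) = \<P>(\<sigma> in mean_replicas. P \<sigma>)"
proof -
  note [measurable] = P
  have "\<P>(\<sigma> in mean_replicas. P \<sigma>) =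
      measure (distr mean_replicas (replicas borel) (relabel \<pi>)) {\<sigma>\<in>space (replicas borel). P \<sigma>}"
    by (simp add: distr_relabel_mean[OF \<pi>] space_mean_replicas)
  also have "\<dots> = \<P>(\<sigma> in mean_replicas. P (relabel \<pi> \<sigma>))"
    using measurable_space[OF measurable_relabel, of _ \<pi>]
    by (subst measure_distr) (auto intro!: arg_cong[where f="measure _"] simp: space_mean_replicas)
  finally show ?thesis ..
qed

lemma mean_average_eq_prob:
  assumes P: "Measurable.pred (replicas borel) P"
    and X: "\<And>\<sigma>. \<sigma> \<in> space (replicas borel) \<Longrightarrow> X \<sigma> = of_bool (P \<sigma>)"
  shows "mean_average M G X = \<P>(\<sigma> in mean_replicas. P \<sigma>)"
proof -
  let ?E = "{\<sigma>\<in>space (replicas borel). P \<sigma>}"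
  have E: "?E \<in> sets (replicas borel)" using P by simp
  have "replica_average (G \<omega>) X = measure (replicas (G \<omega>)) ?E" if "\<omega> \<in> space M" for \<omega>
  proof -
    have sp: "space (replicas (G \<omega>)) = space (replicas borel)"
      by (rule sets_eq_imp_space_eq[OF sets_replicas[OF sets_G[OF that]]])
    have "replica_average (G \<omega>) X = (\<integral>\<sigma>. indicator ?E \<sigma> \<partial>replicas (G \<omega>))"
      unfolding replica_average_def
      by (rule Bochner_Integration.integral_cong) (auto simp: sp X indicator_def)
    also have "\<dots> = measure (replicas (G \<omega>)) (?E \<inter> space (replicas (G \<omega>)))"
      by (rule Bochner_Integration.integral_indicator)
    also have "?E \<inter> space (replicas (G \<omega>)) = ?E" using sp by blast
    finally show ?thesis .
  qed
  then have "mean_average M G X = (\<integral>\<omega>. measure (replicas (G \<omega>)) ?E \<partial>M)"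
    unfolding mean_average_def by (intro Bochner_Integration.integral_cong) auto
  also have "\<dots> = measure mean_replicas ?E"
    unfolding mean_replicas_def
    by (rule measure_bind[symmetric, OF measurable_prob_algebraD[OF measurable_replicas] E])
  finally show ?thesis by (simp add: space_mean_replicas)
qed

lemma overlap_law_eq: "overlap_law M G = distr mean_replicas borel (\<lambda>\<sigma>. overlap \<sigma> 1 2)"
proof -
  have "overlap_law M G = M \<bind> (\<lambda>\<omega>. distr (G \<omega> \<Otimes>\<^sub>M G \<omega>) borel (\<lambda>(x, y). x \<bullet> y))"
    unfolding overlap_law_def
    by (rule distr_bind[where K = "borel \<Otimes>\<^sub>M borel"])
      (auto intro!: measurable_pair_measure measurable_prob_algebraD[OF measurable_G] not_empty)
  also have "\<dots> = M \<bind> (\<lambda>\<omega>. distr (replicas (G \<omega>)) borel (\<lambda>\<sigma>. overlap \<sigma> 1 2))"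
  proof (rule bind_cong[OF refl])
    fix \<omega> assume \<omega>: "\<omega> \<in> space M"
    note [measurable_cong] = sets_G[OF \<omega>]
    have "distr (G \<omega> \<Otimes>\<^sub>M G \<omega>) borel (\<lambda>(x, y). x \<bullet> y) =
        distr (distr (replicas (G \<omega>)) (G \<omega> \<Otimes>\<^sub>M G \<omega>) (\<lambda>\<sigma>. (\<sigma> 1, \<sigma> 2))) borel (\<lambda>(x, y). x \<bullet> y)"
      using distr_PiM_pair[OF prob_space_G[OF \<omega>], of "1::nat" "{1..}" 2] by simp
    also have "\<dots> = distr (replicas (G \<omega>)) borel (\<lambda>\<sigma>. overlap \<sigma> 1 2)"
      by (subst distr_distr) (auto simp: comp_def overlap_def)
    finally show "distr (G \<omega> \<Otimes>\<^sub>M G \<omega>) borel (\<lambda>(x, y). x \<bullet> y) =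
        distr (replicas (G \<omega>)) borel (\<lambda>\<sigma>. overlap \<sigma> 1 2)" .
  qed
  also have "\<dots> = distr mean_replicas borel (\<lambda>\<sigma>. overlap \<sigma> 1 2)"
    unfolding mean_replicas_def
    by (rule distr_bind[symmetric, OF measurable_prob_algebraD[OF measurable_replicas] not_empty
          measurable_overlap])
  finally show ?thesis .
qed

lemma measure_overlap_law:
  assumes "B \<in> sets borel"
  shows "measure (overlap_law M G) B = \<P>(\<sigma> in mean_replicas. overlap \<sigma> 1 2 \<in> B)"
  using assms unfolding overlap_law_eq
  by (subst measure_distr) (auto intro!: arg_cong[where f="measure _"])

text \<open>The Ghirlanda-Guerra identities for indicator functions.\<close>

lemma ghirlanda_guerra_prob:
  assumes gg: "ghirlanda_guerra M G" and n: "2 \<le> n"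
    and F [measurable]: "F \<in> sets (overlap_space n)" and B [measurable]: "B \<in> sets borel"
  shows "\<P>(\<sigma> in mean_replicas. overlap_array n \<sigma> \<in> F \<and> overlap \<sigma> 1 (n + 1) \<in> B) =
    1 / real n * \<P>(\<sigma> in mean_replicas. overlap_array n \<sigma> \<in> F) * measure (overlap_law M G) B +
    1 / real n * (\<Sum>l=2..n. \<P>(\<sigma> in mean_replicas. overlap_array n \<sigma> \<in> F \<and> overlap \<sigma> 1 l \<in> B))"
proof -
  let ?f = "indicator F :: (nat \<times> nat \<Rightarrow> real) \<Rightarrow> real" and ?\<psi> = "indicator B :: real \<Rightarrow> real"
  have bd: "bounded (?f ` space (overlap_space n))" "bounded (range ?\<psi>)"
    by (rule bounded_subset[of "{0, 1}"]; auto simp: indicator_def)+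
  have 1: "mean_average M G (\<lambda>\<sigma>. ?f (overlap_array n \<sigma>) * ?\<psi> (overlap \<sigma> 1 l)) =
      \<P>(\<sigma> in mean_replicas. overlap_array n \<sigma> \<in> F \<and> overlap \<sigma> 1 l \<in> B)" for l
    by (rule mean_average_eq_prob) (auto simp: indicator_def)
  have 2: "mean_average M G (\<lambda>\<sigma>. ?f (overlap_array n \<sigma>)) = \<P>(\<sigma> in mean_replicas. overlap_array n \<sigma> \<in> F)"
    by (rule mean_average_eq_prob) (auto simp: indicator_def)
  have 3: "mean_average M G (\<lambda>\<sigma>. ?\<psi> (overlap \<sigma> 1 2)) = measure (overlap_law M G) B"
    unfolding measure_overlap_law[OF B]
    by (rule mean_average_eq_prob) (auto simp: indicator_def)
  have "?f \<in> borel_measurable (overlap_space n)" "?\<psi> \<in> borel_measurable borel"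
    by measurable
  from gg[unfolded ghirlanda_guerra_def, rule_format, OF n this bd]
  show ?thesis unfolding 1 2 3 .
qed

end

section \<open>Separated replicas do not cover\<close>

lemma transpose_relabels:
  assumes "1 \<le> a" "1 \<le> b"
  shows "inj_on (Transposition.transpose a b) {1::nat..}" "Transposition.transpose a b \<in> {1::nat..} \<rightarrow> {1..}"
  using assms by (auto simp: Transposition.transpose_def inj_on_def split: if_splits)

lemma separated_covered_transpose:
  assumes "a \<in> {1..n} \<longleftrightarrow> b \<in> {1..n}" "a \<in> {n+1..n+m} \<longleftrightarrow> b \<in> {n+1..n+m}"
  shows "separated B n (relabel (Transposition.transpose a b) \<sigma>) \<longleftrightarrow> separated B n \<sigma>"
    and "covered B n m (relabel (Transposition.transpose a b) \<sigma>) \<longleftrightarrow> covered B n m \<sigma>"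
proof -
  have inj: "inj_on (Transposition.transpose a b) {1..n}"
    by (auto simp: Transposition.transpose_def inj_on_def split: if_splits)
  have image: "Transposition.transpose a b ` {1..n} = {1..n}"
      "Transposition.transpose a b ` {n+1..n+m} = {n+1..n+m}"
    using assms by (simp_all only: transpose_image_eq)
  show "separated B n (relabel (Transposition.transpose a b) \<sigma>) \<longleftrightarrow> separated B n \<sigma>"
    by (rule separated_relabel[OF inj image(1)])
  show "covered B n m (relabel (Transposition.transpose a b) \<sigma>) \<longleftrightarrow> covered B n m \<sigma>"
    by (rule covered_relabel[OF image])
qed

context random_measure
begin

text \<open>The identity for \<open>n + m\<close> replicas on the event that the first \<open>n\<close> are separated and cover the
  next \<open>m\<close>. The overlaps with the indices \<open>2, \<dots>, n\<close> do not contribute, and by exchangeability the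
  indices \<open>n + 1, \<dots>, n + m\<close> contribute equally.\<close>

lemma prob_next_close:
  assumes gg: "ghirlanda_guerra M G" and B [measurable]: "B \<in> sets borel" and n: "1 \<le> n" and m: "1 \<le> m"
  defines "E \<equiv> \<lambda>\<sigma>. separated B n \<sigma> \<and> covered B n m \<sigma>"
  shows "\<P>(\<sigma> in mean_replicas. E \<sigma> \<and> overlap \<sigma> 1 (n + m + 1) \<in> B) =
    1 / real (n + m) * (measure (overlap_law M G) B * \<P>(\<sigma> in mean_replicas. E \<sigma>) +
      real m * \<P>(\<sigma> in mean_replicas. E \<sigma> \<and> overlap \<sigma> 1 (n + 1) \<in> B))"
proof -
  let ?N = "n + m"
  let ?P = "\<lambda>l. \<P>(\<sigma> in mean_replicas. E \<sigma> \<and> overlap \<sigma> 1 l \<in> B)"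
  have [measurable]: "Measurable.pred (replicas borel) E"
    unfolding E_def by measurable
  define F where "F = {r\<in>space (overlap_space ?N).
    (\<forall>l\<in>{1..n}. \<forall>l'\<in>{1..n}. l \<noteq> l' \<longrightarrow> r (l, l') \<notin> B) \<and> (\<forall>j\<in>{n+1..n+m}. \<exists>l\<in>{1..n}. r (l, j) \<in> B)}"
  have F: "F \<in> sets (overlap_space ?N)"
    unfolding F_def by measurable
  have FE: "overlap_array ?N \<sigma> \<in> F \<longleftrightarrow> E \<sigma>" for \<sigma>
  proof -
    have "overlap_array ?N \<sigma> \<in> space (overlap_space ?N)"
      by (auto simp: overlap_array_def space_PiM)
    moreover have "overlap_array ?N \<sigma> (l, l') = overlap \<sigma> l l'" if "l \<in> {1..?N}" "l' \<in> {1..?N}" for l l'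
      using that by (simp add: overlap_array_def)
    ultimately show ?thesis
      unfolding F_def E_def separated_def covered_def by auto
  qed
  have "?P (?N + 1) = 1 / real ?N * \<P>(\<sigma> in mean_replicas. E \<sigma>) * measure (overlap_law M G) B +
      1 / real ?N * (\<Sum>l=2..?N. ?P l)"
    using ghirlanda_guerra_prob[OF gg _ F B] n m unfolding FE by simp
  also have "(\<Sum>l=2..?N. ?P l) = (\<Sum>l=n+1..?N. ?P l)"
  proof (rule sum.mono_neutral_right)
    show "\<forall>l\<in>{2..?N} - {n + 1..?N}. ?P l = 0"
    proof
      fix l assume "l \<in> {2..?N} - {n + 1..?N}"
      then have "{\<sigma>\<in>space mean_replicas. E \<sigma> \<and> overlap \<sigma> 1 l \<in> B} = {}"
        unfolding E_def separated_def using n by fastforce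
      then show "?P l = 0" by (simp only: measure_empty)
    qed
  qed (use n in auto)
  also have "\<dots> = (\<Sum>l=n+1..?N. ?P (n + 1))"
  proof (rule sum.cong[OF refl])
    fix j assume j: "j \<in> {n+1..?N}"
    let ?\<pi> = "Transposition.transpose (n + 1) j"
    have "E (relabel ?\<pi> \<sigma>) \<longleftrightarrow> E \<sigma>" for \<sigma>
      unfolding E_def using j
      by (intro arg_cong2[where f="(\<and>)"] separated_covered_transpose) auto
    moreover have "?\<pi> 1 = 1" "?\<pi> j = n + 1"
      using j n by (simp_all add: Transposition.transpose_def)
    ultimately show "?P j = ?P (n + 1)"
      using prob_relabel[of "\<lambda>\<sigma>. E \<sigma> \<and> overlap \<sigma> 1 j \<in> B" ?\<pi>] transpose_relabels[of "n + 1" j] j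
      by simp
  qed
  finally show ?thesis
    by (simp add: algebra_simps)
qed

text \<open>Replica \<open>n + 1\<close> is covered by one of the first \<open>n\<close>, which are exchangeable.\<close>

lemma prob_covered_le:
  assumes B [measurable]: "B \<in> sets borel" and n: "1 \<le> n" and m: "1 \<le> m"
  defines "E \<equiv> \<lambda>\<sigma>. separated B n \<sigma> \<and> covered B n m \<sigma>"
  shows "\<P>(\<sigma> in mean_replicas. E \<sigma>) \<le> real n * \<P>(\<sigma> in mean_replicas. E \<sigma> \<and> overlap \<sigma> 1 (n + 1) \<in> B)"
proof -
  let ?P = "\<lambda>l. \<P>(\<sigma> in mean_replicas. E \<sigma> \<and> overlap \<sigma> l (n + 1) \<in> B)"
  have [measurable]: "Measurable.pred (replicas borel) E"
    unfolding E_def by measurable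
  have "\<P>(\<sigma> in mean_replicas. E \<sigma>) \<le>
      N.prob (\<Union>l\<in>{1..n}. {\<sigma>\<in>space mean_replicas. E \<sigma> \<and> overlap \<sigma> l (n + 1) \<in> B})"
    using m by (intro N.finite_measure_mono) (auto simp: E_def covered_def)
  also have "\<dots> \<le> (\<Sum>l=1..n. ?P l)"
    by (rule N.finite_measure_subadditive_finite) auto
  also have "\<dots> = (\<Sum>l=1..n. ?P 1)"
  proof (rule sum.cong[OF refl])
    fix l assume l: "l \<in> {1..n}"
    let ?\<pi> = "Transposition.transpose 1 l"
    have "E (relabel ?\<pi> \<sigma>) \<longleftrightarrow> E \<sigma>" for \<sigma>
      unfolding E_def using l n
      by (intro arg_cong2[where f="(\<and>)"] separated_covered_transpose) auto
    moreover have "?\<pi> l = 1" "?\<pi> (n + 1) = n + 1"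
      using l n by (simp_all add: Transposition.transpose_def)
    ultimately show "?P l = ?P 1"
      using prob_relabel[of "\<lambda>\<sigma>. E \<sigma> \<and> overlap \<sigma> l (n + 1) \<in> B" ?\<pi>] transpose_relabels[of 1 l] l
      by simp
  qed
  finally show ?thesis by simp
qed

text \<open>If \<open>B\<close> does not have full measure under the overlap law, separated replicas almost surely
  fail to cover some later replica.\<close>

lemma AE_not_covered:
  assumes gg: "ghirlanda_guerra M G" and B [measurable]: "B \<in> sets borel"
    and lt: "measure (overlap_law M G) B < 1" and n: "1 \<le> n"
  shows "AE \<sigma> in mean_replicas. \<not> (separated B n \<sigma> \<and> (\<forall>m. covered B n m \<sigma>))"
proof -
  define E where "E m \<sigma> \<longleftrightarrow> separated B n \<sigma> \<and> covered B n m \<sigma>" for m and \<sigma> :: "nat \<Rightarrow> 'h"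
  have [measurable]: "Measurable.pred (replicas borel) (E m)" for m
    unfolding E_def by measurable
  define b where "b = measure (overlap_law M G) B"
  define c where "c m = \<P>(\<sigma> in mean_replicas. E m \<sigma> \<and> overlap \<sigma> 1 (n + 1) \<in> B)" for m
  define p where "p = \<P>(\<sigma> in mean_replicas. separated B n \<sigma> \<and> (\<forall>m. covered B n m \<sigma>))"
  have p_le: "p \<le> \<P>(\<sigma> in mean_replicas. E m \<sigma>)" for m
    unfolding p_def E_def by (rule N.finite_measure_mono) auto
  have le: "\<P>(\<sigma> in mean_replicas. E (Suc m) \<sigma>) \<le> real n * c (Suc m)" for m
    using prob_covered_le[OF B n, of "Suc m"] unfolding c_def E_def by simp
  have b: "b < 1" "0 \<le> b" using lt by (auto simp: b_def)
  have step: "c (Suc (Suc m)) \<le> c (Suc m) - (1 - b) * p / real (m + n + 1)" for m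
  proof -
    let ?N = "n + Suc m"
    have decrease: "(1 - b) * p \<le> (1 - b) * \<P>(\<sigma> in mean_replicas. E (Suc m) \<sigma>)"
      using p_le b by (intro mult_left_mono) auto
    (* Exchangeability moves the overlap from index n + 1 to ?N + 1, which E (Suc m) does not involve. *)
    have "c (Suc (Suc m)) = \<P>(\<sigma> in mean_replicas. E (Suc (Suc m)) \<sigma> \<and> overlap \<sigma> 1 (?N + 1) \<in> B)"
    proof -
      let ?\<pi> = "Transposition.transpose (n + 1) (?N + 1)"
      have "E (Suc (Suc m)) (relabel ?\<pi> \<sigma>) \<longleftrightarrow> E (Suc (Suc m)) \<sigma>" for \<sigma>
        unfolding E_def
        using n by (intro arg_cong2[where f="(\<and>)"] separated_covered_transpose) auto
      moreover have "?\<pi> 1 = 1" "?\<pi> (?N + 1) = n + 1"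
        using n by (simp_all add: Transposition.transpose_def)
      ultimately show ?thesis
        unfolding c_def
        using prob_relabel[of "\<lambda>\<sigma>. E (Suc (Suc m)) \<sigma> \<and> overlap \<sigma> 1 (?N + 1) \<in> B" ?\<pi>]
          transpose_relabels[of "n + 1" "?N + 1"]
        by simp
    qed
    also have "\<dots> \<le> \<P>(\<sigma> in mean_replicas. E (Suc m) \<sigma> \<and> overlap \<sigma> 1 (?N + 1) \<in> B)"
      by (rule N.finite_measure_mono) (auto simp: E_def covered_def)
    also have "\<dots> = 1 / real ?N * (b * \<P>(\<sigma> in mean_replicas. E (Suc m) \<sigma>) + real (Suc m) * c (Suc m))"
      unfolding E_def b_def c_def by (rule prob_next_close[OF gg B n]) simp
    also have "\<dots> = 1 / real ?N * (\<P>(\<sigma> in mean_replicas. E (Suc m) \<sigma>)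
        - (1 - b) * \<P>(\<sigma> in mean_replicas. E (Suc m) \<sigma>) + real (Suc m) * c (Suc m))"
      by (simp add: algebra_simps)
    also have "\<dots> \<le> 1 / real ?N * (real n * c (Suc m) - (1 - b) * p + real (Suc m) * c (Suc m))"
      by (intro mult_left_mono add_right_mono diff_mono[OF le[of m] decrease]) simp
    also have "\<dots> = c (Suc m) - (1 - b) * p / real (m + n + 1)"
      by (simp add: field_simps)
    finally show ?thesis .
  qed
  have "(1 - b) * p \<le> 0"
    by (rule harmonic_descent[of "\<lambda>m. c (Suc m)", OF step]) (simp add: c_def)
  then have "p \<le> 0" using b by (simp add: mult_le_0_iff)
  then have "p = 0" by (simp add: p_def measure_le_0_iff)
  then have "\<P>(\<sigma> in mean_replicas. separated B n \<sigma> \<and> (\<forall>m. covered B n m \<sigma>)) = 0"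
    by (simp only: p_def)
  then show ?thesis
    by (subst (asm) N.prob_Collect_eq_0) auto
qed

end

text \<open>The step from \<open>n\<close> to \<open>n + 1\<close>: if \<open>n + 1\<close> separated replicas had probability zero, then by
  exchangeability every replica \<open>j > n\<close> would almost surely be covered by any \<open>n\<close> separated ones.\<close>

lemma separated_positive:
  fixes \<nu> :: "'h::{real_inner, second_countable_topology} measure"
  assumes \<nu>: "prob_space \<nu>" "sets \<nu> = sets borel"
    and nc: "\<And>n. 1 \<le> n \<Longrightarrow> AE \<sigma> in replicas \<nu>. \<not> (separated B n \<sigma> \<and> (\<forall>m. covered B n m \<sigma>))"
    and n: "1 \<le> n"
  shows "\<not> (AE \<sigma> in replicas \<nu>. \<not> separated B n \<sigma>)"
  using n
proof (induction n rule: nat_induct_at_least)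
  case base
  interpret prob_space "replicas \<nu>" using \<nu>(1) by (intro prob_space_PiM)
  show ?case by (simp add: separated_def)
next
  case (Suc n)
  show ?case
  proof
    assume ae: "AE \<sigma> in replicas \<nu>. \<not> separated B (Suc n) \<sigma>"
    have "AE \<sigma> in replicas \<nu>. separated B n \<sigma> \<longrightarrow> (\<exists>l\<in>{1..n}. overlap \<sigma> l j \<in> B)" if j: "n + 1 \<le> j" for j
    proof -
      have "AE \<sigma> in replicas \<nu>. \<not> separated B (Suc n) (relabel (Transposition.transpose (n + 1) j) \<sigma>)"
        using transpose_relabels[of "n + 1" j] j by (intro AE_relabel[OF \<nu> _ _ ae]) auto
      then show ?thesis
      proof (rule AE_mp, intro AE_I2 impI)
        fix \<sigma> :: "nat \<Rightarrow> 'h"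
        assume "\<not> separated B (Suc n) (relabel (Transposition.transpose (n + 1) j) \<sigma>)" and sep: "separated B n \<sigma>"
        then obtain l l' where l: "l \<in> {1..n+1}" "l' \<in> {1..n+1}" "l \<noteq> l'"
            "overlap (relabel (Transposition.transpose (n + 1) j) \<sigma>) l l' \<in> B"
          unfolding separated_def by (metis Suc_eq_plus1)
        then have "overlap \<sigma> (Transposition.transpose (n + 1) j l) (Transposition.transpose (n + 1) j l') \<in> B"
          by simp
        note l = l(1-3) this
        have tr: "Transposition.transpose (n + 1) j k = k" if "k \<in> {1..n}" for k
          using that j by (auto simp: Transposition.transpose_def)
        consider "l \<in> {1..n}" "l' \<in> {1..n}" | "l \<in> {1..n}" "l' = n + 1" | "l = n + 1" "l' \<in> {1..n}"
          using l(1-3) by force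
        then show "\<exists>l\<in>{1..n}. overlap \<sigma> l j \<in> B"
        proof cases
          case 1
          then show ?thesis using l(3,4) tr sep by (auto simp: separated_def)
        next
          case 2
          then show ?thesis using l(4) tr by auto
        next
          case 3
          then show ?thesis using l(4) tr overlap_commute[of \<sigma>] by auto
        qed
      qed
    qed
    then have "AE \<sigma> in replicas \<nu>. \<forall>j\<in>{n+1..}. separated B n \<sigma> \<longrightarrow> (\<exists>l\<in>{1..n}. overlap \<sigma> l j \<in> B)"
      by (subst AE_ball_countable) auto
    then have "AE \<sigma> in replicas \<nu>. \<not> separated B n \<sigma>"
      using nc[OF Suc.hyps] by eventually_elim (auto simp: covered_def)
    with Suc.IH show False by blast
  qed
qed

section \<open>Norms of the points of the support\<close>

text \<open>Two replicas fall with positive probability into a neighbourhood of \<open>x\<close> so small that all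
  overlaps of its points exceed any given number below the squared norm of \<open>x\<close>.\<close>

lemma support_norm_le:
  fixes \<nu> :: "'h::{real_inner, second_countable_topology} measure"
  assumes \<nu>: "prob_space \<nu>" "sets \<nu> = sets borel"
    and le: "AE \<sigma> in replicas \<nu>. overlap \<sigma> 1 2 \<le> q"
    and x: "x \<in> measure_support \<nu>"
  shows "(norm x)\<^sup>2 \<le> q"
proof (rule ccontr)
  assume "\<not> (norm x)\<^sup>2 \<le> q"
  then have "x \<bullet> x > q" by (simp add: dot_square_norm)
  have "open {z :: 'h \<times> 'h. fst z \<bullet> snd z > q}"
    by (intro open_Collect_less continuous_intros)
  moreover have "(x, x) \<in> {z. fst z \<bullet> snd z > q}" using \<open>x \<bullet> x > q\<close> by simp
  ultimately obtain A C where AC: "open A" "open C" "x \<in> A" "x \<in> C"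
      "A \<times> C \<subseteq> {z. fst z \<bullet> snd z > q}"
    by (rule open_prod_elim) auto
  define U where "U = A \<inter> C"
  have U: "open U" "x \<in> U" "\<And>y z. y \<in> U \<Longrightarrow> z \<in> U \<Longrightarrow> y \<bullet> z > q"
    using AC by (auto simp: U_def)
  interpret prob_space \<nu> by fact
  interpret P: product_prob_space "\<lambda>_. \<nu>" "{1::nat..}" ..
  have "emeasure (replicas \<nu>) {\<sigma>\<in>space (replicas \<nu>). \<forall>i\<in>{1, 2}. \<sigma> i \<in> U} = (\<Prod>i\<in>{1::nat, 2}. emeasure \<nu> U)"
    using U(1) \<nu>(2) by (intro P.emeasure_PiM_Collect) auto
  also have "\<dots> > 0"
    using x U(1,2) by (auto simp: measure_support_def ennreal_zero_less_mult_iff)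
  finally have pos: "emeasure (replicas \<nu>) {\<sigma>\<in>space (replicas \<nu>). \<forall>i\<in>{1, 2}. \<sigma> i \<in> U} > 0" .
  have "AE \<sigma> in replicas \<nu>. \<not> (\<forall>i\<in>{1, 2}. \<sigma> i \<in> U)"
    using le by eventually_elim (use U(3) in \<open>force simp: overlap_def\<close>)
  moreover have "{\<sigma>\<in>space (replicas \<nu>). \<forall>i\<in>{1, 2}. \<sigma> i \<in> U} \<in> sets (replicas \<nu>)"
  proof -
    have [measurable]: "U \<in> sets \<nu>" using U(1) \<nu>(2) by simp
    show ?thesis by auto
  qed
  ultimately have "emeasure (replicas \<nu>) {\<sigma>\<in>space (replicas \<nu>). \<forall>i\<in>{1, 2}. \<sigma> i \<in> U} = 0"
    by (subst (asm) AE_iff_measurable[OF _ refl]) auto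
  with pos show False by simp
qed

text \<open>By Cauchy-Schwarz, overlaps arbitrarily near \<open>q\<close> with points of norm at most \<open>sqrt q\<close> require
  norm at least \<open>sqrt q\<close>.\<close>

lemma AE_replicas_norm_ge:
  fixes \<nu> :: "'h::{real_inner, second_countable_topology} measure"
  assumes \<nu>: "prob_space \<nu>" "sets \<nu> = sets borel"
    and le: "AE \<sigma> in replicas \<nu>. overlap \<sigma> 1 2 \<le> q"
    and close: "\<And>k::nat. AE \<sigma> in replicas \<nu>. \<exists>j\<ge>1. q - 1 / real (Suc k) < overlap \<sigma> 1 j"
  shows "AE \<sigma> in replicas \<nu>. \<forall>l\<in>{1..}. \<sigma> l \<in> measure_support \<nu> \<and> q \<le> (norm (\<sigma> l))\<^sup>2"
proof -
  have supp: "AE \<sigma> in replicas \<nu>. \<forall>l\<in>{1..}. \<sigma> l \<in> measure_support \<nu>"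
    unfolding AE_ball_countable[OF countable_subset[OF subset_UNIV countableI_type]]
    using AE_measure_support[OF \<nu>(2)] \<nu>(1) by (auto intro!: AE_PiM_component)
  have "AE \<sigma> in replicas \<nu>. \<forall>k::nat. \<exists>j\<ge>1. q - 1 / real (Suc k) < overlap \<sigma> 1 j"
    using close unfolding AE_all_countable by blast
  with supp have first: "AE \<sigma> in replicas \<nu>. q \<le> (norm (\<sigma> 1))\<^sup>2"
  proof eventually_elim
    case (elim \<sigma>)
    have norm_le: "(norm (\<sigma> l))\<^sup>2 \<le> q" if "1 \<le> l" for l
      using support_norm_le[OF \<nu> le] elim(1) that by auto
    then have q: "0 \<le> q" using order_trans[OF zero_le_power2 norm_le[of 1]] by simp
    have "q - 1 / real (Suc k) \<le> norm (\<sigma> 1) * sqrt q" for k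
    proof -
      obtain j where j: "1 \<le> j" "q - 1 / real (Suc k) < \<sigma> 1 \<bullet> \<sigma> j"
        using elim(2) unfolding overlap_def by blast
      have "\<sigma> 1 \<bullet> \<sigma> j \<le> norm (\<sigma> 1) * norm (\<sigma> j)" by (rule norm_cauchy_schwarz)
      also have "\<dots> \<le> norm (\<sigma> 1) * sqrt q"
        using norm_le[OF j(1)] by (intro mult_left_mono real_le_rsqrt) auto
      finally show ?thesis using j(2) by simp
    qed
    moreover have "(\<lambda>k. q - 1 / real (Suc k)) \<longlonglongrightarrow> q - 0"
      using LIMSEQ_inverse_real_of_nat by (intro tendsto_intros) (simp add: inverse_eq_divide)
    ultimately have "q \<le> norm (\<sigma> 1) * sqrt q"
      by (intro LIMSEQ_le_const2[where X="\<lambda>k. q - 1 / real (Suc k)"]) auto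
    then have "sqrt q * sqrt q \<le> norm (\<sigma> 1) * sqrt q" using q by simp
    then have "sqrt q \<le> norm (\<sigma> 1)"
      using q mult_right_le_imp_le[of "sqrt q" "sqrt q" "norm (\<sigma> 1)"] by (cases "q = 0") auto
    then have "(sqrt q)\<^sup>2 \<le> (norm (\<sigma> 1))\<^sup>2" using q by (intro power_mono) auto
    then show ?case using q by simp
  qed
  (* The other replicas have the same law as the first one. *)
  have "AE \<sigma> in replicas \<nu>. q \<le> (norm (\<sigma> l))\<^sup>2" if l: "l \<in> {1..}" for l
    using AE_relabel[OF \<nu> transpose_relabels[of 1 l] first] l
    by (simp add: relabel_def)
  then have "AE \<sigma> in replicas \<nu>. \<forall>l\<in>{1..}. q \<le> (norm (\<sigma> l))\<^sup>2"
    by (subst AE_ball_countable) auto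
  with supp show ?thesis
    by eventually_elim auto
qed

section \<open>The overlap law and the conclusion\<close>

context random_measure
begin

lemma AE_overlap_le_1: "AE \<sigma> in mean_replicas. overlap \<sigma> 1 2 \<le> 1"
proof (rule AE_mean_replicas[THEN iffD2])
  show "AE \<omega> in M. AE \<sigma> in replicas (G \<omega>). overlap \<sigma> 1 2 \<le> 1"
  proof (rule AE_I2)
    fix \<omega> assume \<omega>: "\<omega> \<in> space M"
    have ball: "AE x in G \<omega>. x \<in> cball 0 1"
      using random_prob \<omega> by (intro prob_space.AE_prob_1[OF prob_space_G]) (auto simp: random_prob_on_unit_ball_def)
    have "AE \<sigma> in replicas (G \<omega>). \<sigma> 1 \<in> cball 0 1" "AE \<sigma> in replicas (G \<omega>). \<sigma> 2 \<in> cball 0 1"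
      by (rule AE_PiM_component[OF prob_space_G[OF \<omega>] _ ball]; simp)+
    then show "AE \<sigma> in replicas (G \<omega>). overlap \<sigma> 1 2 \<le> 1"
    proof eventually_elim
      case (elim \<sigma>)
      have "overlap \<sigma> 1 2 \<le> norm (\<sigma> 1) * norm (\<sigma> 2)"
        unfolding overlap_def by (rule norm_cauchy_schwarz)
      also have "\<dots> \<le> 1" using elim by (intro mult_le_one) auto
      finally show ?case .
    qed
  qed
qed measurable

sublocale L: prob_space "overlap_law M G"
  unfolding overlap_law_eq
  by (rule N.prob_space_distr) (simp add: measurable_cong_sets[OF sets_mean_replicas refl])

lemma sets_overlap_law [measurable_cong, simp]: "sets (overlap_law M G) = sets borel"
  by (simp add: overlap_law_def)

lemma space_overlap_law [simp]: "space (overlap_law M G) = UNIV"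
  by (simp add: overlap_law_def)

lemma AE_overlap_law:
  assumes "{x. P x} \<in> sets borel"
  shows "(AE x in overlap_law M G. P x) \<longleftrightarrow> (AE \<sigma> in mean_replicas. P (overlap \<sigma> 1 2))"
  unfolding overlap_law_eq
  using assms by (intro AE_distr_iff) (simp_all add: measurable_cong_sets[OF sets_mean_replicas refl])

lemma overlap_law_support_bdd: "bdd_above (measure_support (overlap_law M G))"
proof (rule bdd_aboveI)
  fix x assume x: "x \<in> measure_support (overlap_law M G)"
  show "x \<le> 1"
  proof (rule ccontr)
    assume "\<not> x \<le> 1"
    then have "0 < emeasure (overlap_law M G) {1<..}"
      using x by (auto simp: measure_support_def)
    moreover have "AE y in overlap_law M G. y \<le> 1"
      using AE_overlap_le_1 by (subst AE_overlap_law) auto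
    then have "emeasure (overlap_law M G) {1<..} = 0"
      by (subst (asm) AE_iff_measurable[where N="{1<..}"]) auto
    ultimately show False by simp
  qed
qed

lemma AE_overlap_law_le_Sup: "AE x in overlap_law M G. x \<le> Sup (measure_support (overlap_law M G))"
  using AE_measure_support[OF sets_overlap_law]
  by eventually_elim (rule cSup_upper[OF _ overlap_law_support_bdd])

lemma overlap_law_near_Sup:
  assumes "c < Sup (measure_support (overlap_law M G))"
  shows "measure (overlap_law M G) {..c} < 1"
proof -
  have "measure_support (overlap_law M G) \<noteq> {}"
    using L.AE_False AE_measure_support[OF sets_overlap_law] by auto
  then obtain x where "x \<in> measure_support (overlap_law M G)" "c < x"
    using less_cSupD[OF _ assms] by blast
  then have "0 < emeasure (overlap_law M G) {c<..}"
    by (auto simp: measure_support_def)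
  then have "0 < measure (overlap_law M G) {c<..}"
    by (simp add: L.emeasure_eq_measure)
  moreover have "measure (overlap_law M G) {c<..} = 1 - measure (overlap_law M G) {..c}"
    using L.prob_compl[of "{..c}"] by (simp add: Compl_eq_Diff_UNIV[symmetric])
  ultimately show ?thesis by simp
qed

lemma AE_not_totally_bounded:
  assumes gg: "ghirlanda_guerra M G"
    and q: "q = Sup (measure_support (overlap_law M G))"
    and atom: "measure (overlap_law M G) {q} < 1"
  shows "AE \<omega> in M. \<not> totally_bounded (measure_support (G \<omega>))"
proof -
  have ae_le: "AE x in overlap_law M G. x \<le> q"
    unfolding q by (rule AE_overlap_law_le_Sup)
  (* Otherwise the overlap law would be the point mass at q. *)
  have "\<exists>k::nat. 0 < measure (overlap_law M G) {..q - 1 / real (Suc k)}"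
  proof (rule ccontr)
    assume "\<not> ?thesis"
    then have zero: "measure (overlap_law M G) {..q - 1 / real (Suc k)} = 0" for k :: nat
      by (metis measure_le_0_iff not_less)
    have "AE x in overlap_law M G. \<not> x \<le> q - 1 / real (Suc k)" for k :: nat
    proof -
      have "{..q - 1 / real (Suc k)} \<in> null_sets (overlap_law M G)"
        using zero[of k] by (intro null_setsI) (simp_all add: L.emeasure_eq_measure)
      then show ?thesis using AE_not_in by fastforce
    qed
    then have "AE x in overlap_law M G. \<forall>k::nat. \<not> x \<le> q - 1 / real (Suc k)"
      unfolding AE_all_countable by blast
    with ae_le have "AE x in overlap_law M G. x \<in> {q}"
    proof eventually_elim
      case (elim x)
      show ?case
      proof (rule ccontr)
        assume "x \<notin> {q}"
        with elim(1) have "0 < q - x" by simp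
        then obtain k :: nat where "1 / real (Suc k) < q - x" by (rule nat_approx_posE)
        with elim(2)[rule_format, of k] show False by simp
      qed
    qed
    then have "measure (overlap_law M G) {q} = 1"
      by (subst L.prob_eq_1) auto
    with atom show False by simp
  qed
  then obtain k0 :: nat where k0: "0 < measure (overlap_law M G) {..q - 1 / real (Suc k0)}" ..
  define c where "c = q - 1 / real (Suc k0)"
  have c: "c < q" by (simp add: c_def)
  have lt1: "measure (overlap_law M G) {c<..} < 1"
    using L.prob_compl[of "{..c}"] k0 by (simp add: c_def Compl_eq_Diff_UNIV[symmetric])

  have le: "AE \<omega> in M. AE \<sigma> in replicas (G \<omega>). overlap \<sigma> 1 2 \<le> q"
    using ae_le by (subst (asm) AE_overlap_law) (auto simp: AE_mean_replicas)
  (* A single replica is trivially separated, so it fails to cover some later one. *)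
  have close: "AE \<omega> in M. \<forall>k::nat. AE \<sigma> in replicas (G \<omega>). \<exists>j\<ge>1. q - 1 / real (Suc k) < overlap \<sigma> 1 j"
  proof (subst AE_all_countable, rule allI)
    fix k :: nat
    have "measure (overlap_law M G) {..q - 1 / real (Suc k)} < 1"
      by (rule overlap_law_near_Sup) (simp add: q[symmetric])
    from AE_not_covered[OF gg borel_closed[OF closed_atMost] this order_refl]
    have "AE \<sigma> in mean_replicas. \<exists>j\<ge>1. q - 1 / real (Suc k) < overlap \<sigma> 1 j"
    proof (rule AE_mp)
      show "AE \<sigma> in mean_replicas.
          \<not> (separated {..q - 1 / real (Suc k)} 1 \<sigma> \<and> (\<forall>m. covered {..q - 1 / real (Suc k)} 1 m \<sigma>)) \<longrightarrow>
          (\<exists>j\<ge>1. q - 1 / real (Suc k) < overlap \<sigma> 1 j)"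
      proof (intro AE_I2 impI)
        fix \<sigma> :: "nat \<Rightarrow> 'h"
        assume "\<not> (separated {..q - 1 / real (Suc k)} 1 \<sigma> \<and> (\<forall>m. covered {..q - 1 / real (Suc k)} 1 m \<sigma>))"
        moreover have "separated {..q - 1 / real (Suc k)} 1 \<sigma>" by (simp add: separated_def)
        ultimately obtain m where "\<not> covered {..q - 1 / real (Suc k)} 1 m \<sigma>" by blast
        then obtain j where j: "j \<in> {1+1..1+m}" "\<forall>l\<in>{1..1}. overlap \<sigma> l j \<notin> {..q - 1 / real (Suc k)}"
          unfolding covered_def by blast
        then show "\<exists>j\<ge>1. q - 1 / real (Suc k) < overlap \<sigma> 1 j"
          by (intro exI[of _ j]) auto
      qed
    qed
    then show "AE \<omega> in M. AE \<sigma> in replicas (G \<omega>). \<exists>j\<ge>1. q - 1 / real (Suc k) < overlap \<sigma> 1 j"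
      by (subst (asm) AE_mean_replicas) auto
  qed
  have sep: "AE \<omega> in M. \<forall>n\<in>{1..}. AE \<sigma> in replicas (G \<omega>).
      \<not> (separated {c<..} n \<sigma> \<and> (\<forall>m. covered {c<..} n m \<sigma>))"
  proof (subst AE_ball_countable)
    show "\<forall>n\<in>{1..}. AE \<omega> in M. AE \<sigma> in replicas (G \<omega>).
        \<not> (separated {c<..} n \<sigma> \<and> (\<forall>m. covered {c<..} n m \<sigma>))"
    proof
      fix n :: nat assume n: "n \<in> {1..}"
      show "AE \<omega> in M. AE \<sigma> in replicas (G \<omega>). \<not> (separated {c<..} n \<sigma> \<and> (\<forall>m. covered {c<..} n m \<sigma>))"
        using AE_not_covered[OF gg borel_open[OF open_greaterThan] lt1, of n] n
        by (simp add: AE_mean_replicas)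
    qed
  qed simp
  from AE_space le close sep show ?thesis
  proof eventually_elim
    case (elim \<omega>)
    note \<nu> = prob_space_G[OF elim(1)] sets_G[OF elim(1)]
    have good: "AE \<sigma> in replicas (G \<omega>). \<forall>l\<in>{1..}. \<sigma> l \<in> measure_support (G \<omega>) \<and> q \<le> (norm (\<sigma> l))\<^sup>2"
      using elim(3) by (intro AE_replicas_norm_ge[OF \<nu> elim(2)]) blast
    show ?case
    proof (rule not_totally_boundedI)
      show "0 < sqrt (2 * (q - c))" using c by simp
      fix n :: nat assume n: "1 \<le> n"
      have "\<not> (AE \<sigma> in replicas (G \<omega>). \<not> separated {c<..} n \<sigma>)"
        using elim(4) by (intro separated_positive[OF \<nu> _ n]) auto
      then obtain \<sigma> where sep: "separated {c<..} n \<sigma>"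
          and \<sigma>: "\<And>l. 1 \<le> l \<Longrightarrow> \<sigma> l \<in> measure_support (G \<omega>)" "\<And>l. 1 \<le> l \<Longrightarrow> q \<le> (norm (\<sigma> l))\<^sup>2"
        using AE_mp[OF good, of "\<lambda>\<sigma>. \<not> separated {c<..} n \<sigma>"] by fastforce
      have "sqrt (2 * (q - c)) \<le> dist (\<sigma> i) (\<sigma> j)" if ij: "i \<in> {1..n}" "j \<in> {1..n}" "i \<noteq> j" for i j
      proof (rule real_le_lsqrt)
        have "\<sigma> i \<bullet> \<sigma> j \<le> c"
          using sep ij by (auto simp: separated_def overlap_def not_less)
        moreover have "(dist (\<sigma> i) (\<sigma> j))\<^sup>2 = (norm (\<sigma> i))\<^sup>2 + (norm (\<sigma> j))\<^sup>2 - 2 * (\<sigma> i \<bullet> \<sigma> j)"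
          by (simp add: dist_norm power2_norm_eq_inner inner_diff inner_commute)
        ultimately show "2 * (q - c) \<le> (dist (\<sigma> i) (\<sigma> j))\<^sup>2"
          using \<sigma>(2)[of i] \<sigma>(2)[of j] ij by auto
      qed auto
      with \<sigma>(1) show "\<exists>x. (\<forall>i\<in>{1..n}. x i \<in> measure_support (G \<omega>)) \<and>
          (\<forall>i\<in>{1..n}. \<forall>j\<in>{1..n}. i \<noteq> j \<longrightarrow> sqrt (2 * (q - c)) \<le> dist (x i) (x j))"
        by (intro exI[of _ \<sigma>]) auto
    qed
  qed
qed

end

theorem corollary2:
  fixes M :: "'w measure"
    and G :: "'w \<Rightarrow> 'h::{real_inner, banach, second_countable_topology} measure"
    and qstar :: real
  assumes "prob_space M"
    and "random_prob_on_unit_ball M G"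
    and "ghirlanda_guerra M G"
    and "qstar = Sup (measure_support (overlap_law M G))"
    and "measure (overlap_law M G) {qstar} < 1"
  shows "AE \<omega> in M. \<not> totally_bounded (measure_support (G \<omega>))"
proof -
  interpret random_measure M G
    using assms(1,2) by (rule random_measure.intro)
  show ?thesis
    using assms(3-5) by (rule AE_not_totally_bounded)
qed

end
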